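(* Let $\lambda=p/q\in(0,1]$ be a reduced fraction (with $p,q$ positive integers) and suppose that either (i) $p\mid q+1$, or (ii) $q$ is odd and $2$ is the least positive integer $\ell$ for which $p\mid q+\ell$. Let $(b_n)_{n\geq 1}$ be the sequence obtained by applying the greedy underapproximation algorithm indefinitely to $p/q$. Then every sequence of integers $2\leq a_1<a_2<\cdots$ such that \[ \sum_{n=1}^{\infty}\frac1{a_n}=\frac pq,\qquad (a_n)_{n\geq 1}\neq(b_n)_{n\geq 1} \] satisfies \[ \liminf_{n\to\infty}a_n^{2^{-n}}<\lim_{n\to\infty}b_n^{2^{-n}} . \]
   Context: The greedy underapproximation algorithm applied to $\lambda\in(0,1]$ produces denominators recursively: $b_1$ is the smallest integer $x\geq 2$ with $1/x<\lambda$, and, given $b_1,\ldots,b_n$, the next denominator $b_{n+1}$ is the smallest integer $x>b_n$ for which $\sum_{i=1}^n 1/b_i+1/x<\lambda$. The limit $\lim_{n\to\infty}b_n^{2^{-n}}$ exists and is finite and strictly positive. *)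

theory Defs
  imports "HOL-Analysis.Analysis"
begin

text \<open>
  Sequences are indexed from 1, so that the exponents \<open>2\<^sup>-\<^sup>n\<close> belong to the
  \<open>n\<close>-th term; the value at index 0 is a dummy.
\<close>

fun greedy_den :: "real \<Rightarrow> nat \<Rightarrow> nat" where
  "greedy_den l 0 = 0"
| "greedy_den l (Suc 0) = (LEAST x. 2 \<le> x \<and> 1 / real x < l)"
| "greedy_den l (Suc (Suc n)) =
     (LEAST x. greedy_den l (Suc n) < x \<and>
        (\<Sum>i\<in>{1..Suc n}. 1 / real (greedy_den l i)) + 1 / real x < l)"

text \<open>For \<open>l > 0\<close> both minima are attained, so \<open>LEAST\<close> is never applied to an empty set.\<close>

lemma ex_den_above:
  assumes "0 < (r::real)"
  shows "\<exists>x::nat. m < x \<and> 1 / real x < r"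
proof -
  obtain k where k: "inverse (real (Suc k)) < r"
    using reals_Archimedean[OF assms] by blast
  have "1 / real (Suc k + m) \<le> inverse (real (Suc k))"
    by (simp add: field_simps)
  with k have "m < Suc k + m \<and> 1 / real (Suc k + m) < r" by linarith
  thus ?thesis by blast
qed

lemma greedy_den_first:
  assumes "0 < l"
  shows "2 \<le> greedy_den l (Suc 0) \<and> 1 / real (greedy_den l (Suc 0)) < l"
proof -
  obtain x :: nat where "1 < x" "1 / real x < l"
    using ex_den_above[OF assms, of 1] by blast
  hence "2 \<le> x \<and> 1 / real x < l" by simp
  thus ?thesis unfolding greedy_den.simps by (rule LeastI)
qed

lemma greedy_den_next_if:
  assumes "(\<Sum>i\<in>{1..Suc n}. 1 / real (greedy_den l i)) < l"
  shows "greedy_den l (Suc n) < greedy_den l (Suc (Suc n)) \<and>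
    (\<Sum>i\<in>{1..Suc n}. 1 / real (greedy_den l i))
      + 1 / real (greedy_den l (Suc (Suc n))) < l"
proof -
  let ?s = "\<Sum>i\<in>{1..Suc n}. 1 / real (greedy_den l i)"
  obtain x :: nat where "greedy_den l (Suc n) < x" "1 / real x < l - ?s"
    using ex_den_above[of "l - ?s" "greedy_den l (Suc n)"] assms by auto
  hence "greedy_den l (Suc n) < x \<and> ?s + 1 / real x < l" by simp
  thus ?thesis unfolding greedy_den.simps(3) by (rule LeastI)
qed

lemma greedy_den_sum_less:
  assumes "0 < l"
  shows "(\<Sum>i\<in>{1..Suc n}. 1 / real (greedy_den l i)) < l"
proof (induction n)
  case 0
  show ?case using greedy_den_first[OF assms] by simp
next
  case (Suc n)
  have "(\<Sum>i\<in>{1..Suc (Suc n)}. 1 / real (greedy_den l i)) =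
      (\<Sum>i\<in>{1..Suc n}. 1 / real (greedy_den l i)) + 1 / real (greedy_den l (Suc (Suc n)))"
    by (rule sum.cl_ivl_Suc[THEN trans]) simp
  thus ?case using greedy_den_next_if[OF Suc] by linarith
qed

lemmas greedy_den_next = greedy_den_next_if[OF greedy_den_sum_less]

end

theory Submission
  imports Defs "HOL-Real_Asymp.Real_Asymp"
begin

text \<open>
  Write \<open>b\<close> for the greedy sequence and \<open>r\<^sub>n\<close>, \<open>R\<^sub>n\<close> for the remainders of \<open>p/q\<close> after \<open>n\<close> terms of
  \<open>a\<close> and of \<open>b\<close>. Clearing denominators gives \<open>r\<^sub>n \<ge> 1 / (q a\<^sub>1 \<cdots> a\<^sub>n)\<close>, and the divisibility
  hypothesis makes this an equality for \<open>b\<close> when \<open>n \<ge> 2\<close>. Summation by parts and \<open>ln x \<le> x - 1\<close> bound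
  \<open>\<Sum>\<^sub>i\<^sub>\<le>\<^sub>n ln (a\<^sub>i / b\<^sub>i)\<close> by \<open>(r\<^sub>n - R\<^sub>n) a\<^sub>n - \<Sum>\<^sub>k\<^sub><\<^sub>n (r\<^sub>k - R\<^sub>k) (a\<^sub>k\<^sub>+\<^sub>1 - a\<^sub>k)\<close>, which by induction yields
  \<open>r\<^sub>n \<ge> R\<^sub>n\<close>, strictly where \<open>a\<close> and \<open>b\<close> first differ.

  If \<open>a\<close> grew as fast as \<open>b\<close>, then \<open>r\<^sub>n a\<^sub>n\<close> would be arbitrarily small for suitable large \<open>n\<close>, so the
  same bound would put \<open>ln (a\<^sub>1 \<cdots> a\<^sub>n)\<close> a fixed amount below \<open>ln (b\<^sub>1 \<cdots> b\<^sub>n)\<close>. Since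
  \<open>a\<^sub>n\<^sub>+\<^sub>1\<close> is at most about \<open>q a\<^sub>1 \<cdots> a\<^sub>n\<close>, this deficit essentially doubles at each further step, which
  lowers the limit of \<open>2\<^sup>-\<^sup>n ln a\<^sub>n\<close>: a contradiction.
\<close>

section \<open>Remainders and the explicit greedy denominators\<close>

definition gap :: "real \<Rightarrow> (nat \<Rightarrow> nat) \<Rightarrow> nat \<Rightarrow> real" where
  "gap l c n = l - (\<Sum>i\<in>{1..n}. 1 / real (c i))"

lemma gap_Suc: "gap l c (Suc n) = gap l c n - 1 / real (c (Suc n))"
  by (simp add: gap_def)

text \<open>The hypotheses say that \<open>m\<close> is \<open>q div p\<close>. As the greedy
  inequality is strict, the successor is chosen even when \<open>p\<close> divides \<open>q\<close>;
  \<open>p \<le> q\<close> makes it at least 2.\<close>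

lemma greedy_den_1_eq:
  assumes "0 < p" "0 < q" "p \<le> q" "q < p * Suc m" "p * m \<le> q"
  shows "greedy_den (real p / real q) 1 = Suc m"
proof -
  have "m \<noteq> 0" using assms by (auto intro: ccontr)
  have iff: "1 / real x < real p / real q \<longleftrightarrow> q < p * x" if "2 \<le> x" for x
  proof -
    have "1 / real x < real p / real q \<longleftrightarrow> real q < real p * real x"
      using that assms by (simp add: field_simps)
    also have "\<dots> \<longleftrightarrow> q < p * x" by (metis of_nat_less_iff of_nat_mult)
    finally show ?thesis .
  qed
  have "(LEAST x. 2 \<le> x \<and> 1 / real x < real p / real q) = Suc m"
  proof (rule Least_equality)
    show "2 \<le> Suc m \<and> 1 / real (Suc m) < real p / real q"
      using iff[of "Suc m"] assms \<open>m \<noteq> 0\<close> by auto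
    fix y assume y: "2 \<le> y \<and> 1 / real y < real p / real q"
    hence "q < p * y" using iff by blast
    hence "p * m < p * y" using assms(5) by linarith
    thus "Suc m \<le> y" by simp
  qed
  thus ?thesis by simp
qed

lemma greedy_den_Suc_Suc_eq:
  assumes gap: "gap l (greedy_den l) (Suc n) = real u / real v"
    and "0 < u" "0 < v" "v < u * Suc x" "u * x \<le> v" "greedy_den l (Suc n) \<le> x"
  shows "greedy_den l (Suc (Suc n)) = Suc x"
proof -
  let ?s = "\<Sum>i\<in>{1..Suc n}. 1 / real (greedy_den l i)"
  have iff: "?s + 1 / real y < l \<longleftrightarrow> v < u * y" if "0 < y" for y
  proof -
    have "?s + 1 / real y < l \<longleftrightarrow> 1 / real y < real u / real v"
      using gap unfolding gap_def by linarith
    also have "\<dots> \<longleftrightarrow> real v < real u * real y"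
      using that assms by (simp add: field_simps)
    also have "\<dots> \<longleftrightarrow> v < u * y" by (metis of_nat_less_iff of_nat_mult)
    finally show ?thesis .
  qed
  show ?thesis unfolding greedy_den.simps(3)
  proof (rule Least_equality)
    show "greedy_den l (Suc n) < Suc x \<and> ?s + 1 / real (Suc x) < l"
      using iff[of "Suc x"] assms by auto
    fix y assume y: "greedy_den l (Suc n) < y \<and> ?s + 1 / real y < l"
    hence "v < u * y" using iff[of y] by auto
    hence "u * x < u * y" using assms(5) by linarith
    thus "Suc x \<le> y" by simp
  qed
qed

lemma greedy_den_pos:
  assumes "0 < l" "1 \<le> n"
  shows "0 < greedy_den l n"
proof (cases n)
  case (Suc m)
  show ?thesis
  proof (cases m)
    case 0
    thus ?thesis using greedy_den_first[OF assms(1)] Suc by auto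
  next
    case (Suc k)
    thus ?thesis using greedy_den_next[OF assms(1), of k] \<open>n = Suc m\<close> by auto
  qed
qed (use assms in simp)

text \<open>A remainder \<open>1 / s\<close> forces the choice \<open>s + 1\<close>, and
  \<open>1 / s - 1 / (s + 1) = 1 / (s * (s + 1))\<close>, so the unit-fraction shape reproduces
  itself.\<close>

lemma greedy_den_unit_gap_step:
  assumes "0 < l" "0 < q"
    and gap: "gap l (greedy_den l) (Suc n) = 1 / real (q * (\<Prod>i\<in>{1..Suc n}. greedy_den l i))"
  shows "greedy_den l (Suc (Suc n)) = Suc (q * (\<Prod>i\<in>{1..Suc n}. greedy_den l i))"
    and "gap l (greedy_den l) (Suc (Suc n)) = 1 / real (q * (\<Prod>i\<in>{1..Suc (Suc n)}. greedy_den l i))"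
proof -
  define Q where "Q = (\<Prod>i\<in>{1..n}. greedy_den l i)"
  define s where "s = q * (\<Prod>i\<in>{1..Suc n}. greedy_den l i)"
  have "0 < Q" unfolding Q_def using greedy_den_pos[OF assms(1)] by (intro prod_pos) auto
  have s: "s = q * Q * greedy_den l (Suc n)"
    by (simp add: s_def Q_def)
  have "0 < q * Q" using \<open>0 < Q\<close> assms by simp
  hence ge: "greedy_den l (Suc n) \<le> s" unfolding s by (cases "q * Q") auto
  have "0 < s" using ge greedy_den_pos[OF assms(1), of "Suc n"] by simp
  have nxt: "greedy_den l (Suc (Suc n)) = Suc s"
    by (rule greedy_den_Suc_Suc_eq[where u = 1 and v = s])
       (use gap ge \<open>0 < s\<close> in \<open>auto simp: s_def\<close>)
  thus "greedy_den l (Suc (Suc n)) = Suc (q * (\<Prod>i\<in>{1..Suc n}. greedy_den l i))"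
    by (simp add: s_def)
  have "gap l (greedy_den l) (Suc (Suc n)) = 1 / real s - 1 / real (Suc s)"
    using gap unfolding gap_Suc[of _ _ "Suc n"] nxt s_def by simp
  also have "\<dots> = 1 / real (s * Suc s)"
    using \<open>0 < s\<close> by (simp add: field_simps)
  also have "s * Suc s = q * (\<Prod>i\<in>{1..Suc (Suc n)}. greedy_den l i)"
    by (simp add: s_def nxt[unfolded s_def] del: mult_Suc_right greedy_den.simps)
  finally show "gap l (greedy_den l) (Suc (Suc n)) = 1 / real (q * (\<Prod>i\<in>{1..Suc (Suc n)}. greedy_den l i))" .
qed

text \<open>If \<open>p dvd q + 1\<close>, the shape appears after one term and is carried to two.
  Otherwise the first remainder has numerator 2 and odd denominator \<open>2 * x + 1\<close>; the
  choice \<open>x + 1\<close> then lowers the numerator to 1.\<close>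

lemma greedy_gap_2:
  assumes "0 < p" "0 < q" "p \<le> q"
    and "p dvd q + 1 \<or> (odd q \<and> p dvd q + 2)"
  defines "l \<equiv> real p / real q"
  shows "gap l (greedy_den l) (Suc (Suc 0)) =
    1 / real (q * (\<Prod>i\<in>{1..Suc (Suc 0)}. greedy_den l i))"
proof -
  have l: "0 < l" using assms by (simp add: l_def)
  show ?thesis
  proof (cases "p dvd q + 1")
    case True
    then obtain k where k: "q + 1 = p * k" by blast
    then obtain m where m: "k = Suc m" by (cases k) auto
    have b1: "greedy_den l 1 = Suc m" unfolding l_def
      by (rule greedy_den_1_eq) (use assms k m in auto)
    have "real p * real (Suc m) = real q + 1"
      by (metis k m of_nat_1 of_nat_add of_nat_mult)
    hence "real p / real q - 1 / real (Suc m) = 1 / real (q * Suc m)"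
      using \<open>0 < q\<close> by (simp add: field_simps)
    hence "gap l (greedy_den l) (Suc 0) = 1 / real (q * (\<Prod>i\<in>{1..Suc 0}. greedy_den l i))"
      using b1 by (simp add: gap_def l_def del: greedy_den.simps)
    from greedy_den_unit_gap_step(2)[OF l assms(2) this] show ?thesis .
  next
    case False
    with assms have "odd q" and "p dvd q + 2" by auto
    from \<open>p dvd q + 2\<close> obtain k where k: "q + 2 = p * k" by blast
    then obtain m where m: "k = Suc m" by (cases k) auto
    \<comment> \<open>Both 1 and 2 divide the even number \<open>q + 1\<close>.\<close>
    have "p \<noteq> 1" "p \<noteq> 2" using False \<open>odd q\<close> by auto
    hence p3: "3 \<le> p" using \<open>0 < p\<close> by linarith
    have b1: "greedy_den l 1 = Suc m" unfolding l_def
      by (rule greedy_den_1_eq) (use assms k m p3 in auto)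
    have "odd (Suc m)" using k m \<open>odd q\<close> by (metis even_add even_mult_iff even_numeral)
    hence "odd (q * Suc m)" using \<open>odd q\<close> by simp
    then obtain x where x: "q * Suc m = Suc (2 * x)" by (metis oddE Suc_eq_plus1)
    have "real p * real (Suc m) = real q + 2"
      by (metis k m of_nat_numeral of_nat_add of_nat_mult)
    hence "real p / real q - 1 / real (Suc m) = 2 / real (q * Suc m)"
      using \<open>0 < q\<close> by (simp add: field_simps)
    hence gap1: "gap l (greedy_den l) (Suc 0) = real 2 / real (q * Suc m)"
      using b1 by (simp add: gap_def l_def del: greedy_den.simps)
    have "3 * Suc m \<le> q * Suc m" using p3 assms(3) by (intro mult_le_mono1) linarith
    hence "Suc m \<le> x" unfolding x by simp
    have b2: "greedy_den l (Suc (Suc 0)) = Suc x"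
      by (rule greedy_den_Suc_Suc_eq[OF gap1]) (use x b1 \<open>Suc m \<le> x\<close> in auto)
    have xr: "real q * real (Suc m) = 2 * real x + 1"
      by (metis x of_nat_mult of_nat_Suc of_nat_numeral add.commute)
    have "gap l (greedy_den l) (Suc (Suc 0)) = 2 / (2 * real x + 1) - 1 / real (Suc x)"
      unfolding gap_Suc[of _ _ "Suc 0"] gap1 b2 by (simp only: of_nat_mult xr of_nat_numeral)
    also have "\<dots> = 1 / ((2 * real x + 1) * real (Suc x))"
      by (simp add: field_simps)
    also have "\<dots> = 1 / real (q * (\<Prod>i\<in>{1..Suc (Suc 0)}. greedy_den l i))"
      unfolding xr[symmetric] using b1 b2 by (simp add: algebra_simps del: greedy_den.simps)
    finally show ?thesis .
  qed
qed

lemma greedy_gap: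
  assumes "0 < p" "0 < q" "p \<le> q"
    and "p dvd q + 1 \<or> (odd q \<and> p dvd q + 2)"
    and "2 \<le> n"
  defines "l \<equiv> real p / real q"
  shows "gap l (greedy_den l) n = 1 / real (q * (\<Prod>i\<in>{1..n}. greedy_den l i))"
    and "greedy_den l (Suc n) = Suc (q * (\<Prod>i\<in>{1..n}. greedy_den l i))"
proof -
  have l: "0 < l" using assms by (simp add: l_def)
  show *: "gap l (greedy_den l) n = 1 / real (q * (\<Prod>i\<in>{1..n}. greedy_den l i))"
    using assms(5)
  proof (induction n rule: nat_induct_at_least)
    case base
    show ?case using greedy_gap_2[OF assms(1-4)] unfolding l_def numeral_2_eq_2 .
  next
    case (Suc n)
    then obtain k where "n = Suc k" by (cases n) auto
    with Suc greedy_den_unit_gap_step(2)[OF l assms(2), of k] show ?case by metis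
  qed
  obtain k where "n = Suc k" using assms(5) by (cases n) auto
  with * greedy_den_unit_gap_step(1)[OF l assms(2), of k]
  show "greedy_den l (Suc n) = Suc (q * (\<Prod>i\<in>{1..n}. greedy_den l i))" by metis
qed

section \<open>Comparison of the two remainders\<close>

lemma gap_ge_inverse_prod:
  fixes p q n :: nat
  assumes "0 < q" and "\<And>i. 1 \<le> i \<Longrightarrow> 0 < a i" and pos: "0 < gap (real p / real q) a n"
  shows "1 / real (q * (\<Prod>i\<in>{1..n}. a i)) \<le> gap (real p / real q) a n"
proof -
  have "\<exists>z::int. real (q * (\<Prod>i\<in>{1..n}. a i)) * gap (real p / real q) a n = of_int z"
  proof (induction n)
    case 0
    show ?case using assms(1) by (intro exI[of _ "int p"]) (simp add: gap_def)
  next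
    case (Suc n)
    then obtain z :: int
      where z: "real (q * (\<Prod>i\<in>{1..n}. a i)) * gap (real p / real q) a n = of_int z" by blast
    have "real (q * (\<Prod>i\<in>{1..Suc n}. a i)) * gap (real p / real q) a (Suc n) =
      (real (q * (\<Prod>i\<in>{1..n}. a i)) * gap (real p / real q) a n) * real (a (Suc n))
        - real (q * (\<Prod>i\<in>{1..n}. a i))"
      using assms(2)[of "Suc n"] by (simp add: gap_Suc field_simps)
    also have "\<dots> = of_int (z * int (a (Suc n)) - int (q * (\<Prod>i\<in>{1..n}. a i)))"
      unfolding z by simp
    finally show ?case by blast
  qed
  then obtain z :: int
    where z: "real (q * (\<Prod>i\<in>{1..n}. a i)) * gap (real p / real q) a n = of_int z" by blast
  have P: "0 < q * (\<Prod>i\<in>{1..n}. a i)"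
    using assms(1,2) by (auto intro!: prod_pos)
  hence P': "0 < real (q * (\<Prod>i\<in>{1..n}. a i))" by (simp only: of_nat_0_less_iff)
  have "0 < real_of_int z" unfolding z[symmetric] using P' pos by (rule mult_pos_pos)
  hence "1 \<le> real_of_int z" by simp
  thus ?thesis using z P' by (simp add: pos_divide_le_eq mult.commute del: of_nat_mult)
qed

text \<open>Abel summation of \<open>a i / b i - 1 = (1 / b i - 1 / a i) * a i\<close>. As
  \<open>D 0 = 0\<close>, the dummy value \<open>a 0\<close> has no influence.\<close>

lemma sum_ratio_by_parts:
  fixes a b :: "nat \<Rightarrow> real"
  assumes "\<And>i. 1 \<le> i \<Longrightarrow> a i \<noteq> 0"
  defines "D \<equiv> \<lambda>n. \<Sum>i\<in>{1..n}. 1 / b i - 1 / a i"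
  shows "(\<Sum>i\<in>{1..n}. a i / b i - 1) = D n * a n - (\<Sum>k<n. D k * (a (Suc k) - a k))"
proof (induction n)
  case (Suc n)
  have D: "D (Suc n) = D n + (1 / b (Suc n) - 1 / a (Suc n))" by (simp add: D_def)
  show ?case using Suc assms(1)[of "Suc n"] by (simp add: D algebra_simps)
qed (simp add: D_def)

lemma ln_of_nat_prod:
  fixes a :: "nat \<Rightarrow> nat"
  assumes "\<And>i. 1 \<le> i \<Longrightarrow> 0 < a i"
  shows "ln (real (\<Prod>i\<in>{1..n}. a i)) = (\<Sum>i\<in>{1..n}. ln (real (a i)))"
  unfolding of_nat_prod using assms by (intro ln_prod) auto

text \<open>Transfers information from remainders to products: \<open>ln x \<le> x - 1\<close> at
  each ratio, then summation by parts, with \<open>l\<close> cancelling in the differences of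
  remainders.\<close>

lemma ln_prod_diff_le:
  fixes a b :: "nat \<Rightarrow> nat"
  assumes a: "\<And>i. 1 \<le> i \<Longrightarrow> 0 < a i" and b: "\<And>i. 1 \<le> i \<Longrightarrow> 0 < b i"
  shows "ln (real (\<Prod>i\<in>{1..n}. a i)) - ln (real (\<Prod>i\<in>{1..n}. b i)) \<le>
    (gap l a n - gap l b n) * real (a n)
      - (\<Sum>k<n. (gap l a k - gap l b k) * (real (a (Suc k)) - real (a k)))"
proof -
  have "ln (real (\<Prod>i\<in>{1..n}. a i)) - ln (real (\<Prod>i\<in>{1..n}. b i)) =
      (\<Sum>i\<in>{1..n}. ln (real (a i)) - ln (real (b i)))"
    using ln_of_nat_prod[of a n] ln_of_nat_prod[of b n] a b by (simp add: sum_subtractf)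
  also have "\<dots> \<le> (\<Sum>i\<in>{1..n}. real (a i) / real (b i) - 1)"
  proof (rule sum_mono)
    fix i assume "i \<in> {1..n}"
    hence i: "0 < real (a i)" "0 < real (b i)" using a b by auto
    hence "ln (real (a i)) - ln (real (b i)) = ln (real (a i) / real (b i))"
      by (simp add: ln_div)
    also have "\<dots> \<le> real (a i) / real (b i) - 1" using i by (intro ln_le_minus_one) simp
    finally show "ln (real (a i)) - ln (real (b i)) \<le> real (a i) / real (b i) - 1" .
  qed
  also have "\<dots> = (gap l a n - gap l b n) * real (a n)
      - (\<Sum>k<n. (gap l a k - gap l b k) * (real (a (Suc k)) - real (a k)))"
  proof -
    have D: "(\<Sum>i\<in>{1..k}. 1 / real (b i) - 1 / real (a i)) = gap l a k - gap l b k" for k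
      by (simp add: gap_def sum_subtractf)
    show ?thesis
      using sum_ratio_by_parts[of "\<lambda>i. real (a i)" "\<lambda>i. real (b i)" n] a
      unfolding D by force
  qed
  finally show ?thesis .
qed

text \<open>At a first failure \<open>n \<ge> 2\<close>, all terms of \<open>ln_prod_diff_le\<close>
  have the favourable sign, so the product of \<open>a\<close> is at most the greedy product. Since
  the greedy remainder is exactly the reciprocal bound and the other is at least its own, the
  failure is refuted.\<close>

lemma greedy_gap_le:
  fixes p q :: nat and a :: "nat \<Rightarrow> nat"
  assumes pq: "0 < p" "0 < q" "p \<le> q"
    and dvd: "p dvd q + 1 \<or> (odd q \<and> p dvd q + 2)"
    and a1: "2 \<le> a 1" and mono: "\<And>i. 1 \<le> i \<Longrightarrow> a i \<le> a (Suc i)"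
  defines "l \<equiv> real p / real q"
  assumes pos: "\<And>n. 0 < gap l a n"
  shows "gap l (greedy_den l) n \<le> gap l a n"
proof (induction n rule: less_induct)
  case (less n)
  let ?b = "greedy_den l"
  have l: "0 < l" using pq by (simp add: l_def)
  have apos: "0 < a i" if "1 \<le> i" for i
    using that by (induction i rule: nat_induct_at_least) (use a1 mono in \<open>auto intro: less_le_trans\<close>)
  consider "n = 0" | "n = 1" | "2 \<le> n" by linarith
  thus ?case
  proof cases
    case 1
    thus ?thesis by (simp add: gap_def)
  next
    \<comment> \<open>The explicit remainder starts at index 2, so index 1 is settled by minimality
      of the first greedy denominator.\<close>
    case 2
    have "2 \<le> a 1 \<and> 1 / real (a 1) < l" using pos[of 1] a1 by (simp add: gap_def)
    hence "?b 1 \<le> a 1" by (simp add: Least_le)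
    hence "1 / real (a 1) \<le> 1 / real (?b 1)"
      using greedy_den_pos[OF l, of 1] by (intro divide_left_mono) auto
    thus ?thesis using 2 by (simp add: gap_def del: greedy_den.simps)
  next
    case 3
    show ?thesis
    proof (rule ccontr)
      assume "\<not> ?thesis"
      hence neg: "gap l a n < gap l ?b n" by simp
      have "0 \<le> (\<Sum>k<n. (gap l a k - gap l ?b k) * (real (a (Suc k)) - real (a k)))"
      proof (rule sum_nonneg)
        fix k assume "k \<in> {..<n}"
        hence "0 \<le> gap l a k - gap l ?b k" using less by simp
        \<comment> \<open>At \<open>k = 0\<close> monotonicity says nothing about
          \<open>a 0\<close>, but there both remainders equal \<open>l\<close>.\<close>
        moreover have "0 \<le> real (a (Suc k)) - real (a k)" if "k \<noteq> 0"
          using mono[of k] that by simp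
        ultimately show "0 \<le> (gap l a k - gap l ?b k) * (real (a (Suc k)) - real (a k))"
          by (cases "k = 0") (auto simp: gap_def)
      qed
      moreover have "(gap l a n - gap l ?b n) * real (a n) \<le> 0"
        using neg by (intro mult_nonpos_nonneg) auto
      ultimately have "ln (real (\<Prod>i\<in>{1..n}. a i)) \<le> ln (real (\<Prod>i\<in>{1..n}. ?b i))"
        using ln_prod_diff_le[of a ?b n l] apos greedy_den_pos[OF l] by force
      moreover have P: "0 < (\<Prod>i\<in>{1..n}. a i)" "0 < (\<Prod>i\<in>{1..n}. ?b i)"
        using apos greedy_den_pos[OF l] by (auto intro!: prod_pos)
      ultimately have "real (\<Prod>i\<in>{1..n}. a i) \<le> real (\<Prod>i\<in>{1..n}. ?b i)"
        by (subst (asm) ln_le_cancel_iff) (simp_all only: of_nat_0_less_iff)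
      hence "real (q * (\<Prod>i\<in>{1..n}. a i)) \<le> real (q * (\<Prod>i\<in>{1..n}. ?b i))"
        by (simp only: of_nat_le_iff mult_le_mono2)
      hence "1 / real (q * (\<Prod>i\<in>{1..n}. ?b i)) \<le> 1 / real (q * (\<Prod>i\<in>{1..n}. a i))"
      proof (rule divide_left_mono)
        show "0 < real (q * (\<Prod>i\<in>{1..n}. ?b i)) * real (q * (\<Prod>i\<in>{1..n}. a i))"
          unfolding of_nat_mult[symmetric] of_nat_0_less_iff using P pq by simp
      qed simp
      also have "\<dots> \<le> gap l a n"
        unfolding l_def by (rule gap_ge_inverse_prod) (use apos pos pq in \<open>auto simp: l_def\<close>)
      finally have "gap l ?b n \<le> gap l a n"
        using greedy_gap(1)[OF pq dvd 3] by (simp only: l_def)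
      with neg show False by simp
    qed
  qed
qed


section \<open>Growth of \<open>a\<close>, small remainders and amplification of a deficit\<close>

lemma gap_sums:
  assumes "(\<lambda>n. 1 / real (a (Suc n))) sums l"
  shows "(\<lambda>k. 1 / real (a (Suc (k + n)))) sums gap l a n"
proof -
  have "gap l a n + (\<Sum>i<n. 1 / real (a (Suc i))) = l"
    by (simp add: gap_def sum.atLeast1_atMost_eq)
  thus ?thesis using assms by (subst sums_iff_shift) simp
qed

text \<open>The remainder is a tail starting at index \<open>n + 1\<close>, where
  \<open>2 ^ i / 2 \<ge> 2 ^ n\<close>. So half the rate in the denominators gives the full rate in
  the remainder, and the factors \<open>2 ^ i\<close> supply a geometric series.\<close>

lemma gap_le_of_growth:
  assumes sums: "(\<lambda>n. 1 / real (a (Suc n))) sums l" and "0 < L"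
    and ev: "eventually (\<lambda>i. 2 ^ i * exp (L * 2 ^ i / 2) \<le> real (a i)) sequentially"
  shows "eventually (\<lambda>n. gap l a n \<le> exp (- L * 2 ^ n) / 2 ^ n) sequentially"
proof -
  from ev obtain N where N: "\<And>i. N \<le> i \<Longrightarrow> 2 ^ i * exp (L * 2 ^ i / 2) \<le> real (a i)"
    unfolding eventually_sequentially by blast
  have "gap l a n \<le> exp (- L * 2 ^ n) / 2 ^ n" if "N \<le> n" for n
  proof (rule sums_le[OF _ gap_sums[OF sums]])
    show "(\<lambda>k. exp (- L * 2 ^ n) / 2 ^ n * (1 / 2) ^ Suc k) sums (exp (- L * 2 ^ n) / 2 ^ n)"
      using sums_mult[OF power_half_series, of "exp (- L * 2 ^ n) / 2 ^ n"] by simp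
    fix k
    let ?i = "Suc (k + n)"
    have "(2::real) ^ Suc n \<le> 2 ^ ?i" by (rule power_increasing) auto
    hence "L * 2 ^ n \<le> L * 2 ^ ?i / 2" using \<open>0 < L\<close> by simp
    hence "2 ^ ?i * exp (L * 2 ^ n) \<le> 2 ^ ?i * exp (L * 2 ^ ?i / 2)" by simp
    also have "\<dots> \<le> real (a ?i)" using that by (intro N) simp
    finally have *: "2 ^ ?i * exp (L * 2 ^ n) \<le> real (a ?i)" .
    moreover have "0 < 2 ^ ?i * exp (L * 2 ^ n)" by simp
    ultimately have "1 / real (a ?i) \<le> 1 / (2 ^ ?i * exp (L * 2 ^ n))"
      by (intro divide_left_mono mult_pos_pos[of "real (a ?i)"]) linarith+
    also have "\<dots> = exp (- L * 2 ^ n) / 2 ^ n * (1 / 2) ^ Suc k"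
      by (simp add: exp_minus field_simps power_add)
    finally show "1 / real (a ?i) \<le> exp (- L * 2 ^ n) / 2 ^ n * (1 / 2) ^ Suc k" .
  qed
  thus ?thesis unfolding eventually_sequentially by blast
qed

text \<open>Supplies the indices at which the boundary term of \<open>ln_prod_diff_le\<close> is
  harmless.\<close>

lemma frequently_mult_gap_le:
  assumes apos: "\<And>i. 1 \<le> i \<Longrightarrow> 0 < a i" and pos: "\<And>n. 0 < gap l a n"
    and "0 < L" "0 < d"
    and ev: "eventually (\<lambda>n. gap l a n \<le> exp (- L * 2 ^ n) / 2 ^ n) sequentially"
  shows "frequently (\<lambda>n. real (a n) * gap l a n \<le> d) sequentially"
proof (rule ccontr)
  assume "\<not> ?thesis"
  hence "eventually (\<lambda>n. d < real (a n) * gap l a n) sequentially"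
    by (simp add: not_frequently not_le)
  with ev have "eventually (\<lambda>n. d < real (a n) * gap l a n \<and>
      gap l a n \<le> exp (- L * 2 ^ n) / 2 ^ n) sequentially"
    by eventually_elim simp
  then obtain N where N: "\<And>n. N \<le> n \<Longrightarrow> d < real (a n) * gap l a n"
      "\<And>n. N \<le> n \<Longrightarrow> gap l a n \<le> exp (- L * 2 ^ n) / 2 ^ n"
    unfolding eventually_sequentially by blast
  \<comment> \<open>If \<open>d < real (a n) * gap l a n\<close>, then adding back the reciprocal of
    \<open>a n\<close> enlarges the remainder by less than the factor \<open>1 + 1 / d\<close>,
    whose inverse is this ratio.\<close>
  define \<rho> where "\<rho> = d / (1 + d)"
  have \<rho>: "0 < \<rho>" using \<open>0 < d\<close> by (simp add: \<rho>_def)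
  \<comment> \<open>The gap would then decay only geometrically, against the assumed doubly exponential bound.\<close>
  have lower: "gap l a N * \<rho> ^ k \<le> gap l a (N + k)" for k
  proof (induction k)
    case (Suc k)
    let ?n = "N + k"
    have "d < real (a (Suc ?n)) * gap l a (Suc ?n)" by (rule N) simp
    hence "d / real (a (Suc ?n)) < gap l a (Suc ?n)"
      using apos[of "Suc ?n"] by (simp add: field_simps)
    hence "d * (gap l a ?n - gap l a (Suc ?n)) \<le> gap l a (Suc ?n)"
      by (simp add: gap_Suc)
    hence "\<rho> * gap l a ?n \<le> gap l a (Suc ?n)"
      using \<open>0 < d\<close> by (simp add: \<rho>_def field_simps)
    moreover have "\<rho> * (gap l a N * \<rho> ^ k) \<le> \<rho> * gap l a ?n"
      using Suc \<rho> by (intro mult_left_mono) auto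
    ultimately show ?case by (simp add: mult_ac)
  qed simp
  have upper: "gap l a (N + k) \<le> exp (- L * 2 ^ k)" for k
  proof -
    have "gap l a (N + k) \<le> exp (- L * 2 ^ (N + k)) / 2 ^ (N + k)" by (rule N) simp
    also have "\<dots> \<le> exp (- L * 2 ^ (N + k)) / 1"
      by (intro divide_left_mono) auto
    also have "\<dots> \<le> exp (- L * 2 ^ k)"
      using \<open>0 < L\<close> by (simp add: power_increasing)
    finally show ?thesis .
  qed
  have "gap l a N \<le> exp (- L * 2 ^ k) / \<rho> ^ k" for k
    using lower[of k] upper[of k] \<rho> by (simp add: pos_le_divide_eq)
  moreover have "(\<lambda>k. exp (- L * 2 ^ k) / \<rho> ^ k) \<longlonglongrightarrow> 0"
    using \<open>0 < L\<close> \<rho> by real_asymp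
  ultimately have "gap l a N \<le> 0" by (intro LIMSEQ_le_const) auto
  with pos[of N] show False by simp
qed

text \<open>The bounds on the remainders give
  \<open>ln (real (a (Suc n))) \<le> T n + 1 / 2 ^ n\<close>, hence
  \<open>T (Suc n) \<le> 2 * T n + 1 / 2 ^ n\<close>. A deficit of \<open>T n\<close> below
  \<open>2 ^ Suc n * L\<close> thus doubles up to a tiny error and survives division by
  \<open>2 ^ n\<close>.\<close>

lemma ln_le_of_deficit:
  fixes a :: "nat \<Rightarrow> nat"
  assumes apos: "\<And>i. 1 \<le> i \<Longrightarrow> 0 < a i" and q: "0 < q" and L: "0 < L" and d: "0 < d"
    and lower: "\<And>n. 1 / real (q * (\<Prod>i\<in>{1..n}. a i)) \<le> gap l a n"
    and upper: "eventually (\<lambda>n. gap l a n \<le> exp (- L * 2 ^ n) / 2 ^ n) sequentially"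
    and deficit: "frequently (\<lambda>n. ln (real (q * (\<Prod>i\<in>{1..n}. a i))) \<le> 2 ^ Suc n * L - d) sequentially"
  shows "\<exists>\<kappa><L. eventually (\<lambda>n. ln (real (a n)) \<le> 2 ^ n * \<kappa>) sequentially"
proof -
  define Q where "Q n = real (q * (\<Prod>i\<in>{1..n}. a i))" for n
  define T where "T n = ln (Q n)" for n
  have Q: "0 < Q n" for n
    using apos q unfolding Q_def of_nat_0_less_iff by (auto intro!: prod_pos)
  have "eventually (\<lambda>n. 1 / 2 ^ n < d / 2) sequentially"
    using d by real_asymp
  with upper have "eventually (\<lambda>n. gap l a n \<le> exp (- L * 2 ^ n) / 2 ^ n \<and> 1 / 2 ^ n < d / 2) sequentially"
    by eventually_elim simp
  then obtain N where N: "\<And>n. N \<le> n \<Longrightarrow> gap l a n \<le> exp (- L * 2 ^ n) / 2 ^ n"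
      "\<And>n. N \<le> n \<Longrightarrow> 1 / 2 ^ n < d / 2"
    unfolding eventually_sequentially by blast
  \<comment> \<open>The reciprocal of \<open>a (Suc n)\<close> is a difference of consecutive
    remainders: the first is at least \<open>1 / Q n\<close>, and the condition on
    \<open>T n\<close> makes the second at most \<open>x / Q n\<close>.\<close>
  have step: "ln (real (a (Suc n))) \<le> T n + 1 / 2 ^ n" if "N \<le> n" and T: "T n \<le> 2 ^ Suc n * L" for n
  proof -
    define x :: real where "x = 1 / 2 ^ Suc n"
    have x: "0 < x" "x \<le> 1 / 2" unfolding x_def by (auto simp: field_simps)
    have A: "0 < real (a (Suc n))" using apos by simp
    have "gap l a (Suc n) \<le> exp (- L * 2 ^ Suc n) * x"
      using N(1)[of "Suc n"] that by (simp add: x_def)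
    also have "\<dots> \<le> exp (- T n) * x" using T x by (intro mult_right_mono) (auto simp: mult.commute)
    also have "exp (- T n) = 1 / Q n" using Q by (simp add: T_def exp_minus divide_inverse)
    finally have "(1 - x) / Q n \<le> gap l a n - gap l a (Suc n)"
      using lower[of n, folded Q_def] by (simp add: diff_divide_distrib)
    hence "(1 - x) / Q n \<le> 1 / real (a (Suc n))" by (simp add: gap_Suc)
    hence "(1 - x) * real (a (Suc n)) \<le> Q n" using Q A by (simp add: field_simps)
    \<comment> \<open>For \<open>0 < x \<le> 1 / 2\<close> the product
      \<open>(1 + 2 * x) * (1 - x)\<close> is at least 1.\<close>
    hence "(1 + 2 * x) * ((1 - x) * real (a (Suc n))) \<le> (1 + 2 * x) * Q n"
      using x by (intro mult_left_mono) auto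
    moreover have "(1 + 2 * x) * ((1 - x) * real (a (Suc n)))
        = real (a (Suc n)) + x * (1 - 2 * x) * real (a (Suc n))"
      by (simp add: algebra_simps)
    moreover have "0 \<le> x * (1 - 2 * x) * real (a (Suc n))" using x by simp
    ultimately have "real (a (Suc n)) \<le> (1 + 2 * x) * Q n" by linarith
    hence "ln (real (a (Suc n))) \<le> ln ((1 + 2 * x) * Q n)" using A by simp
    also have "\<dots> = ln (1 + 2 * x) + T n" using Q[of n] x by (simp add: T_def ln_mult)
    also have "\<dots> \<le> 2 * x + T n" using x ln_add_one_self_le_self[of "2 * x"] by simp
    finally show ?thesis by (simp add: x_def)
  qed
  obtain n where n: "N \<le> n" "T n \<le> 2 ^ Suc n * L - d"
    using deficit unfolding frequently_sequentially T_def Q_def by blast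
  \<comment> \<open>The deficit is split into a fixed reserve \<open>d / 2\<close> and a doubling
    part. Doubling the reserve frees a further \<open>d / 2\<close>, which absorbs the
    error.\<close>
  have T: "T (n + k) \<le> 2 ^ Suc (n + k) * L - d / 2 - 2 ^ k * (d / 2)" for k
  proof (induction k)
    case 0
    thus ?case using n by simp
  next
    case (Suc k)
    have "Q (Suc (n + k)) = Q (n + k) * real (a (Suc (n + k)))"
      by (simp add: Q_def)
    hence "T (Suc (n + k)) = T (n + k) + ln (real (a (Suc (n + k))))"
      using Q[of "n + k"] apos by (simp add: T_def ln_mult)
    also have "ln (real (a (Suc (n + k)))) \<le> T (n + k) + 1 / 2 ^ (n + k)"
    proof (rule step)
      have "0 \<le> d / 2 + 2 ^ k * (d / 2)" using d by simp
      thus "T (n + k) \<le> 2 ^ Suc (n + k) * L" using Suc by linarith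
    qed (use n in simp)
    finally show ?case using Suc N(2)[of "n + k"] n(1) by simp
  qed
  \<comment> \<open>The reserve pays for the last error; the constant is
    \<open>2 ^ k * (d / 2)\<close> divided by \<open>2 ^ j\<close>, where
    \<open>j = Suc (n + k)\<close>.\<close>
  have "ln (real (a j)) \<le> 2 ^ j * (L - d / (2 * 2 ^ Suc n))" if "Suc n \<le> j" for j
  proof -
    obtain k where j: "j = Suc (n + k)" using \<open>Suc n \<le> j\<close> by (metis le_iff_add add_Suc)
    have "T (n + k) \<le> 2 ^ Suc (n + k) * L"
    proof -
      have "0 \<le> d / 2 + 2 ^ k * (d / 2)" using d by simp
      thus ?thesis using T[of k] by linarith
    qed
    hence "ln (real (a j)) \<le> T (n + k) + 1 / 2 ^ (n + k)"
      unfolding j using n by (intro step) auto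
    also have "\<dots> \<le> 2 ^ j * L - 2 ^ k * (d / 2)"
      using T[of k] N(2)[of "n + k"] n(1) by (simp add: j)
    also have "\<dots> = 2 ^ j * (L - d / (2 * 2 ^ Suc n))"
      by (simp add: j power_add field_simps)
    finally show ?thesis .
  qed
  hence "eventually (\<lambda>j. ln (real (a j)) \<le> 2 ^ j * (L - d / (2 * 2 ^ Suc n))) sequentially"
    unfolding eventually_sequentially by blast
  moreover have "L - d / (2 * 2 ^ Suc n) < L" using d by simp
  ultimately show ?thesis by blast
qed

section \<open>Growth of the greedy sequence\<close>

lemma powr_two_powr_minus:
  assumes "0 < x"
  shows "x powr (2 powr (- real n)) = exp (ln x / 2 ^ n)"
  using assms by (simp add: powr_def[of x] powr_minus powr_realpow divide_inverse mult.commute)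

text \<open>The product bound with the same \<open>L\<close> later turns a deficit against the
  greedy product into one against \<open>L\<close>. From \<open>s (Suc k) = s k * (s k + 1)\<close>,
  squaring \<open>s k\<close> underestimates the next term and squaring \<open>s k + 1\<close>
  overestimates its successor, so \<open>U\<close> stays below the limit \<open>L\<close> of
  \<open>V\<close>.\<close>

lemma greedy_growth:
  assumes pq: "0 < p" "0 < q" "p \<le> q"
    and dvd: "p dvd q + 1 \<or> (odd q \<and> p dvd q + 2)"
  defines "l \<equiv> real p / real q"
  obtains L where "0 < L"
    "(\<lambda>n. real (greedy_den l n) powr (2 powr (- real n))) \<longlonglongrightarrow> exp L"
    "\<And>n. 2 \<le> n \<Longrightarrow> ln (real (q * (\<Prod>i\<in>{1..n}. greedy_den l i))) \<le> 2 ^ Suc n * L"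
proof -
  have l: "0 < l" using pq by (simp add: l_def)
  define s where "s k = real (q * (\<Prod>i\<in>{1..k + 2}. greedy_den l i))" for k
  have b: "real (greedy_den l (k + 3)) = s k + 1" for k
    using greedy_gap(2)[OF pq dvd, of "k + 2"]
    by (simp add: s_def l_def eval_nat_numeral del: greedy_den.simps)
  have s_Suc: "s (Suc k) = s k * (s k + 1)" for k
    using b[of k] by (simp add: s_def eval_nat_numeral del: greedy_den.simps)
  \<comment> \<open>Strictly above 1, so that \<open>0 < U 0\<close>, which forces
    \<open>0 < L\<close>.\<close>
  have s0: "1 < s 0"
  proof -
    have "2 * 1 \<le> greedy_den l 1 * greedy_den l 2"
      using greedy_den_first[OF l] greedy_den_pos[OF l, of 2]
      by (intro mult_le_mono) (auto simp del: greedy_den.simps)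
    also have "\<dots> \<le> q * (greedy_den l 1 * greedy_den l 2)" using pq by simp
    also have "\<dots> = q * (\<Prod>i\<in>{1..0 + 2}. greedy_den l i)"
      by (simp add: eval_nat_numeral del: greedy_den.simps)
    finally show ?thesis unfolding s_def by linarith
  qed
  have s: "1 < s k" for k
  proof (induction k)
    case (Suc k)
    hence "1 * 1 < s k * (s k + 1)" by (intro mult_strict_mono) auto
    thus ?case by (simp add: s_Suc)
  qed (rule s0)
  \<comment> \<open>The exponents are chosen to match the index shift \<open>b\<^sub>k\<^sub>+\<^sub>3 = s k + 1\<close>; \<open>U\<close> increases, \<open>V\<close> decreases.\<close>
  define V where "V k = ln (s k + 1) / 2 ^ (k + 3)" for k
  define U where "U k = ln (s k) / 2 ^ (k + 3)" for k
  have "V (Suc k) \<le> V k" for k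
  proof -
    have "s (Suc k) + 1 \<le> (s k + 1) ^ 2"
      using s[of k] by (simp add: s_Suc power2_eq_square algebra_simps)
    hence "ln (s (Suc k) + 1) \<le> ln ((s k + 1) ^ 2)"
      using s[of "Suc k"] by (intro ln_mono) linarith+
    also have "\<dots> = 2 * ln (s k + 1)" using s[of k] by (simp add: ln_realpow)
    finally show ?thesis by (simp add: V_def power_add field_simps)
  qed
  hence "decseq V" by (simp add: decseq_Suc_iff)
  moreover have "0 \<le> V k" for k using s[of k] by (simp add: V_def)
  ultimately obtain L where L: "V \<longlonglongrightarrow> L" using decseq_convergent[of V 0] by blast
  have "U k \<le> U (Suc k)" for k
  proof -
    have "s k ^ 2 \<le> s (Suc k)"
      using s[of k] by (simp add: s_Suc power2_eq_square algebra_simps)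
    hence "ln (s k ^ 2) \<le> ln (s (Suc k))" using s[of k] by (intro ln_mono) auto
    hence "2 * ln (s k) \<le> ln (s (Suc k))" using s[of k] by (simp add: ln_realpow)
    thus ?thesis by (simp add: U_def power_add field_simps)
  qed
  hence "incseq U" by (simp add: incseq_Suc_iff)
  have "U k \<le> V k" for k using s[of k] by (auto simp: U_def V_def intro!: divide_right_mono)
  have UL: "U k \<le> L" for k
  proof (rule LIMSEQ_le_const[OF L], intro exI allI impI)
    fix j assume "k \<le> j"
    hence "U k \<le> U j" using \<open>incseq U\<close> by (simp add: incseqD)
    also have "\<dots> \<le> V j" by fact
    finally show "U k \<le> V j" .
  qed
  show thesis
  proof (rule that)
    have "0 < U 0" using s[of 0] by (simp add: U_def)
    thus "0 < L" using UL[of 0] by linarith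
    have "real (greedy_den l (k + 3)) powr (2 powr (- real (k + 3))) = exp (V k)" for k
      unfolding b V_def by (rule powr_two_powr_minus) (use s[of k] in simp)
    hence "(\<lambda>k. real (greedy_den l (k + 3)) powr (2 powr (- real (k + 3)))) \<longlonglongrightarrow> exp L"
      using tendsto_exp[OF L] by presburger
    thus "(\<lambda>n. real (greedy_den l n) powr (2 powr (- real n))) \<longlonglongrightarrow> exp L"
      by (rule LIMSEQ_offset)
    fix n :: nat assume "2 \<le> n"
    then obtain k where n: "n = k + 2" by (metis le_iff_add add.commute)
    have "ln (s k) \<le> 2 ^ (k + 3) * L"
      using UL[of k] by (simp add: U_def field_simps)
    thus "ln (real (q * (\<Prod>i\<in>{1..n}. greedy_den l i))) \<le> 2 ^ Suc n * L"
      unfolding n s_def by (simp add: eval_nat_numeral del: greedy_den.simps)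
  qed
qed

section \<open>Contradiction from the assumed growth of \<open>a\<close>\<close>

theorem mainTheorem5:
  fixes p q :: nat and a :: "nat \<Rightarrow> nat"
  assumes "0 < p" and "0 < q" and "coprime p q" and "real p / real q \<le> 1"
    and "p dvd q + 1 \<or> (odd q \<and> (LEAST l. 0 < l \<and> p dvd q + l) = 2)"
    and "2 \<le> a 1" and "strict_mono_on {1..} a"
    and "(\<lambda>n. 1 / real (a (Suc n))) sums (real p / real q)"
    and "\<exists>n\<ge>1. a n \<noteq> greedy_den (real p / real q) n"
  shows "liminf (\<lambda>n. ereal (real (a n) powr (2 powr (- real n))))
    < ereal (lim (\<lambda>n. real (greedy_den (real p / real q) n) powr (2 powr (- real n))))"
proof (rule ccontr)
  define l where "l = real p / real q"
  let ?b = "greedy_den l"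
  let ?D = "\<lambda>k. gap l a k - gap l ?b k"
  have l: "0 < l" using assms by (simp add: l_def)
  have "p \<le> q" using assms by simp
  have dvd: "p dvd q + 1 \<or> (odd q \<and> p dvd q + 2)"
  proof -
    have "p dvd q + 2" if "(LEAST l. 0 < l \<and> p dvd q + l) = 2"
    proof -
      \<comment> \<open>The shift \<open>p * (q + 1) - q\<close> is a witness that the
        \<open>LEAST\<close> is attained.\<close>
      have "p * (q + 1) = q + (p * (q + 1) - q)" "0 < p * (q + 1) - q"
        using assms(1) by (cases p; simp)+
      hence "\<exists>l. 0 < l \<and> p dvd q + l" by (metis dvd_triv_left)
      from LeastI_ex[OF this] show ?thesis using that by simp
    qed
    thus ?thesis using assms(5) by blast
  qed
  note pq = assms(1,2) \<open>p \<le> q\<close> dvd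
  have a_less: "a i < a (Suc i)" if "1 \<le> i" for i
    using assms(7) that by (auto intro: strict_mono_onD)
  have apos: "0 < a i" if "1 \<le> i" for i
    using that by (induction i rule: nat_induct_at_least) (use assms(6) a_less in \<open>auto intro: less_trans\<close>)
  have bpos: "0 < ?b i" if "1 \<le> i" for i using greedy_den_pos[OF l that] .
  note sums = assms(8)[folded l_def]
  have pos: "0 < gap l a n" for n
    using suminf_pos[OF sums_summable[OF gap_sums[OF sums]], of n] sums_unique[OF gap_sums[OF sums], of n]
      apos by simp
  have D_nonneg: "0 \<le> ?D k" for k
    using greedy_gap_le[OF pq, of a k] assms(6) a_less pos by (force simp: l_def intro: less_imp_le)
  obtain L where L: "0 < L" "(\<lambda>n. real (?b n) powr (2 powr (- real n))) \<longlonglongrightarrow> exp L"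
    "\<And>n. 2 \<le> n \<Longrightarrow> ln (real (q * (\<Prod>i\<in>{1..n}. ?b i))) \<le> 2 ^ Suc n * L"
    using greedy_growth[OF pq] unfolding l_def by blast
  assume "\<not> ?thesis"
  hence liminf: "ereal (exp L) \<le> liminf (\<lambda>n. ereal (real (a n) powr (2 powr (- real n))))"
    using limI[OF L(2)] by (simp add: l_def)
  have growth: "eventually (\<lambda>n. 2 ^ n * \<kappa> < ln (real (a n))) sequentially" if "\<kappa> < L" for \<kappa>
  proof -
    have "ereal (exp \<kappa>) < liminf (\<lambda>n. ereal (real (a n) powr (2 powr (- real n))))"
      by (rule less_le_trans[OF _ liminf]) (use that in simp)
    from less_LiminfD[OF this] eventually_ge_at_top[of 1] show ?thesis
    proof eventually_elim
      case (elim n)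
      hence "exp \<kappa> < exp (ln (real (a n)) / 2 ^ n)"
        using powr_two_powr_minus[of "real (a n)" n] apos[of n] by simp
      thus ?case by (simp add: field_simps)
    qed
  qed
  \<comment> \<open>The rate \<open>3 / 4 * L\<close> lies below \<open>L\<close>, so
    \<open>growth\<close> applies, and its surplus over \<open>L / 2\<close> absorbs
    \<open>2 ^ n\<close>.\<close>
  have "eventually (\<lambda>n. 2 ^ n * exp (L * 2 ^ n / 2) \<le> exp (2 ^ n * (3 / 4 * L))) sequentially"
    using L(1) by real_asymp
  moreover have "eventually (\<lambda>n. 2 ^ n * (3 / 4 * L) < ln (real (a n))) sequentially"
    using L(1) by (intro growth) simp
  ultimately have "eventually (\<lambda>n. 2 ^ n * exp (L * 2 ^ n / 2) \<le> real (a n)) sequentially"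
    using eventually_ge_at_top[of 1]
  proof eventually_elim
    case (elim n)
    have "exp (2 ^ n * (3 / 4 * L)) < real (a n)"
      using elim apos[of n] by (metis exp_less_cancel_iff exp_ln of_nat_0_less_iff)
    with elim show ?case by linarith
  qed
  note gap_upper = gap_le_of_growth[OF sums L(1) this]

  define m where "m = (LEAST n. 1 \<le> n \<and> a n \<noteq> ?b n)"
  have m: "1 \<le> m \<and> a m \<noteq> ?b m" unfolding m_def
    by (rule LeastI_ex) (use assms(9) in \<open>auto simp: l_def\<close>)
  have below_m: "a i = ?b i" if "1 \<le> i" "i < m" for i
    using not_less_Least[of i "\<lambda>n. 1 \<le> n \<and> a n \<noteq> ?b n"] that by (auto simp: m_def)
  obtain m' where m': "m = Suc m'" using m by (cases m) auto
  \<comment> \<open>At the first difference the remainders differ by one pair of reciprocals only,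
    so \<open>?D m\<close> is nonzero and, being nonnegative, positive.\<close>
  have "gap l a m' = gap l ?b m'" using below_m m' by (simp add: gap_def)
  hence "?D m = 1 / real (?b m) - 1 / real (a m)" unfolding m' gap_Suc by simp
  moreover have "1 / real (?b m) \<noteq> 1 / real (a m)" using m by (simp add: frac_eq_eq)
  ultimately have "0 < ?D m" using D_nonneg[of m] by linarith
  \<comment> \<open>Half, since index \<open>m\<close> contributes at least \<open>2 * d\<close> to
    the subtracted sum and the boundary term gives back at most \<open>d\<close>.\<close>
  define d where "d = ?D m / 2"
  have d: "0 < d" using \<open>0 < ?D m\<close> by (simp add: d_def)

  have "frequently (\<lambda>n. real (a n) * gap l a n \<le> d) sequentially"
    by (rule frequently_mult_gap_le[OF apos pos L(1) d gap_upper])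
  \<comment> \<open>This puts \<open>m\<close> inside the sum over \<open>k < n\<close> and ensures
    \<open>2 \<le> n\<close> for the product bound.\<close>
  moreover have "eventually (\<lambda>n. m + 2 \<le> n) sequentially" by (rule eventually_ge_at_top)
  ultimately have "frequently (\<lambda>n. m + 2 \<le> n \<and> real (a n) * gap l a n \<le> d) sequentially"
    by (rule frequently_eventually_conj)
  hence "frequently (\<lambda>n. ln (real (q * (\<Prod>i\<in>{1..n}. a i))) \<le> 2 ^ Suc n * L - d) sequentially"
  proof (rule frequently_elim1)
    fix n assume n: "m + 2 \<le> n \<and> real (a n) * gap l a n \<le> d"
    let ?t = "\<lambda>k. ?D k * (real (a (Suc k)) - real (a k))"
    \<comment> \<open>Consecutive terms are distinct integers, so they differ by at least 1.\<close>
    have "?D m * 1 \<le> ?t m"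
      using a_less[of m] m D_nonneg[of m] by (intro mult_left_mono) auto
    also have "?t m \<le> (\<Sum>k<n. ?t k)"
    proof (rule member_le_sum)
      fix k
      have "0 \<le> real (a (Suc k)) - real (a k)" if "k \<noteq> 0" using a_less[of k] that by simp
      thus "0 \<le> ?t k" using D_nonneg[of k] by (cases "k = 0") (auto simp: gap_def)
    qed (use n in auto)
    finally have "2 * d \<le> (\<Sum>k<n. ?t k)" by (simp add: d_def)
    \<comment> \<open>The greedy remainder is positive, so \<open>?D n\<close> is at most
      \<open>gap l a n\<close>.\<close>
    moreover have "?D n * real (a n) \<le> d"
    proof -
      have "0 \<le> gap l ?b n * real (a n)"
        using greedy_den_sum_less[OF l, of "n - 1"] n by (simp add: gap_def)
      thus ?thesis using n by (simp add: algebra_simps)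
    qed
    ultimately have "ln (real (\<Prod>i\<in>{1..n}. a i)) - ln (real (\<Prod>i\<in>{1..n}. ?b i)) \<le> - d"
      using ln_prod_diff_le[of a ?b n l, OF apos bpos] by linarith
    moreover have "ln (real (q * P)) = ln (real q) + ln (real P)" if "0 < P" for P
      using that assms(2) by (simp add: ln_mult)
    note this[of "\<Prod>i\<in>{1..n}. a i"] this[of "\<Prod>i\<in>{1..n}. ?b i"]
    moreover have "0 < (\<Prod>i\<in>{1..n}. a i)" "0 < (\<Prod>i\<in>{1..n}. ?b i)"
      using apos bpos by (auto intro!: prod_pos)
    moreover have "ln (real (q * (\<Prod>i\<in>{1..n}. ?b i))) \<le> 2 ^ Suc n * L"
      using n by (intro L(3)) simp
    ultimately show "ln (real (q * (\<Prod>i\<in>{1..n}. a i))) \<le> 2 ^ Suc n * L - d"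
      by linarith
  qed
  moreover have "1 / real (q * (\<Prod>i\<in>{1..n}. a i)) \<le> gap l a n" for n
    unfolding l_def by (rule gap_ge_inverse_prod) (use assms(2) apos pos in \<open>auto simp: l_def\<close>)
  ultimately obtain \<kappa> where "\<kappa> < L"
    and "eventually (\<lambda>n. ln (real (a n)) \<le> 2 ^ n * \<kappa>) sequentially"
    using ln_le_of_deficit[OF apos assms(2) L(1) d _ gap_upper] by blast
  from growth[OF this(1)] this(2) have "eventually (\<lambda>n::nat. False) sequentially"
    by eventually_elim simp
  thus False by simp
qed

end
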